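(* Let $(\widetilde J_2(n))_{n\ge0}$ be defined by $\widetilde J_2(0)=1$, $\widetilde J_2(1)=\frac34$ and $4n^2\widetilde J_2(n)-(8n^2-8n+3)\widetilde J_2(n-1)+4(n-1)^2\widetilde J_2(n-2)=0$ for $n\ge2$, and let $(\widetilde J_3(n))_{n\ge0}$ be defined by $\widetilde J_3(0)=0$, $\widetilde J_3(1)=\frac12$ and $4n^2\widetilde J_3(n)-(8n^2-8n+3)\widetilde J_3(n-1)+4(n-1)^2\widetilde J_3(n-2)=\frac{2^n(n-1)!}{(2n-1)!!}$ for $n\ge2$. Then for every odd prime $p$ and all positive integers $m,r$, $$\widetilde J_2(mp^r)\equiv\widetilde J_2(mp^{r-1})\pmod{p^r},\qquad \widetilde J_3(p^r)p^{3r}\equiv\widetilde J_3(p^{r-1})p^{3(r-1)}\pmod{p^r}.$$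
   Context: Congruences of rational numbers: for $x,y\in\mathbb{Q}$ and a positive integer $R$, write $x\equiv y\pmod R$ if $x-y=\frac{RN}{D}$ for some $N,D\in\mathbb{Z}$ with $D$ relatively prime to $R$. $(2n-1)!!=1\cdot3\cdots(2n-1)$. *)

theory Defs
  imports "HOL-Computational_Algebra.Primes" "HOL.Rat"
begin

text \<open>\<open>D \<noteq> 0\<close> follows from coprimality unless \<open>R = 1\<close>, where all rationals are congruent anyway.\<close>

definition rat_cong :: "rat \<Rightarrow> rat \<Rightarrow> nat \<Rightarrow> bool"
    (\<open>(\<open>indent=1 notation=\<open>mixfix rat_cong\<close>\<close>[_ \<equiv> _] '(rmod _'))\<close>) where
  "[x \<equiv> y] (rmod R) \<longleftrightarrow>
     (\<exists>N D :: int. D \<noteq> 0 \<and> coprime D (int R) \<and> x - y = of_nat R * of_int N / of_int D)"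

text \<open>\<open>odd_double_fact n\<close> is \<open>(2n - 1)!!\<close>, indexed by the number of factors.\<close>

definition odd_double_fact :: "nat \<Rightarrow> nat" where
  "odd_double_fact n = (\<Prod>k = 1..n. 2 * k - 1)"

text \<open>The recurrences are solved for the leading term, with index \<open>n = k + 2\<close>; the lemmas
  \<open>Jt2_recurrence\<close> and \<open>Jt3_recurrence\<close> below give them in their original form.\<close>

fun Jt2 :: "nat \<Rightarrow> rat" where
  "Jt2 0 = 1"
| "Jt2 (Suc 0) = 3 / 4"
| "Jt2 (Suc (Suc k)) =
     (let n = of_nat (Suc (Suc k)) in
       ((8 * n^2 - 8 * n + 3) * Jt2 (Suc k) - 4 * (n - 1)^2 * Jt2 k) / (4 * n^2))"

fun Jt3 :: "nat \<Rightarrow> rat" where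
  "Jt3 0 = 0"
| "Jt3 (Suc 0) = 1 / 2"
| "Jt3 (Suc (Suc k)) =
     (let n = of_nat (Suc (Suc k)) in
       ((8 * n^2 - 8 * n + 3) * Jt3 (Suc k) - 4 * (n - 1)^2 * Jt3 k
         + 2 ^ Suc (Suc k) * fact (Suc k) / of_nat (odd_double_fact (Suc (Suc k)))) / (4 * n^2))"

lemma Jt2_recurrence:
  assumes "n \<ge> 2"
  shows "4 * of_nat n^2 * Jt2 n - (8 * of_nat n^2 - 8 * of_nat n + 3) * Jt2 (n - 1)
           + 4 * (of_nat n - 1)^2 * Jt2 (n - 2) = 0"
proof -
  obtain k where n: "n = Suc (Suc k)"
    using assms by (metis add_2_eq_Suc le_Suc_ex)
  have nz: "4 * (of_nat n :: rat)^2 \<noteq> 0"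
    using n by simp
  have "Jt2 n = ((8 * of_nat n^2 - 8 * of_nat n + 3) * Jt2 (n - 1)
           - 4 * (of_nat n - 1)^2 * Jt2 (n - 2)) / (4 * of_nat n^2)"
    unfolding n by (simp only: Jt2.simps Let_def diff_Suc_1 diff_Suc_Suc diff_zero numeral_2_eq_2)
  then show ?thesis
    using nz by (simp add: nonzero_eq_divide_eq mult.commute)
qed

lemma Jt3_recurrence:
  assumes "n \<ge> 2"
  shows "4 * of_nat n^2 * Jt3 n - (8 * of_nat n^2 - 8 * of_nat n + 3) * Jt3 (n - 1)
           + 4 * (of_nat n - 1)^2 * Jt3 (n - 2)
         = 2 ^ n * fact (n - 1) / of_nat (odd_double_fact n)"
proof -
  obtain k where n: "n = Suc (Suc k)"
    using assms by (metis add_2_eq_Suc le_Suc_ex)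
  have nz: "4 * (of_nat n :: rat)^2 \<noteq> 0"
    using n by simp
  have "Jt3 n = ((8 * of_nat n^2 - 8 * of_nat n + 3) * Jt3 (n - 1)
           - 4 * (of_nat n - 1)^2 * Jt3 (n - 2)
           + 2 ^ n * fact (n - 1) / of_nat (odd_double_fact n)) / (4 * of_nat n^2)"
    unfolding n by (simp only: Jt3.simps Let_def diff_Suc_1 diff_Suc_Suc diff_zero numeral_2_eq_2)
  then have "Jt3 n * (4 * of_nat n^2) = (8 * of_nat n^2 - 8 * of_nat n + 3) * Jt3 (n - 1)
           - 4 * (of_nat n - 1)^2 * Jt3 (n - 2)
           + 2 ^ n * fact (n - 1) / of_nat (odd_double_fact n)"
    by (subst (asm) nonzero_eq_divide_eq[OF nz])
  then show ?thesis
    by (simp only: mult.commute[of "Jt3 n"])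
qed

end

theory Submission
  imports Defs "HOL-Computational_Algebra.Polynomial"
begin

text \<open>Write \<open>c k = binom(2 k, k) / 4 ^ k\<close>. The Apery operator sends \<open>binom(n, k)\<close> to
  \<open>(2 k + 1)\<^sup>2 binom(n - 1, k) + 4 k\<^sup>2 binom(n - 1, k - 1)\<close>, which yields the closed forms
  \<open>Jt2 n = \<Sum>k. (-1) ^ k binom(n, k) (c k)\<^sup>2\<close> and
  \<open>Jt3 n = \<Sum>k. (-1) ^ k binom(n, k) (c k)\<^sup>2 S k\<close> with
  \<open>S k = -2 \<Sum>j<k. 1 / ((2 j + 1) ^ 3 (c j)\<^sup>2)\<close>.
  For \<open>n = p ^ r m\<close>, the congruence \<open>(1 + X) ^ n \<equiv> (1 + X ^ p) ^ (n / p)\<close> modulo \<open>p ^ r\<close>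
  kills the summands with \<open>p\<close> not dividing \<open>k\<close> and matches those at \<open>p k\<close> with the summands at
  \<open>k\<close> for \<open>n / p\<close>. The same happens inside \<open>p ^ (3 r) S k\<close>: only the terms with
  \<open>2 j + 1\<close> divisible by \<open>p\<close> survive modulo \<open>p ^ r\<close>.\<close>

section \<open>Closed forms\<close>

text \<open>This is \<open>(-1) ^ n\<close> times the generalized binomial coefficient of
  \<open>-1/2\<close> over \<open>n\<close>. Its only denominators are powers of 2, so it is
  integral at every odd prime.\<close>

definition central :: "nat \<Rightarrow> rat" where
  "central n = of_nat ((2 * n) choose n) / 4 ^ n"

lemma central_0 [simp]: "central 0 = 1"
  by (simp add: central_def)

lemma central_pos: "central n > 0"
  by (simp add: central_def)

lemma central_binomial_Suc:
  "Suc n * ((2 * Suc n) choose Suc n) = 2 * (2 * n + 1) * ((2 * n) choose n)"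
proof -
  have 1: "(2 * n + 2) * ((2 * n + 1) choose n) = ((2 * Suc n) choose Suc n) * Suc n"
    using Suc_times_binomial_eq[of "2 * n + 1" n] by simp
  have 2: "Suc n * ((2 * n + 1) choose n) = (2 * n + 1) * ((2 * n) choose n)"
    using binomial_absorb_comp[of "2 * n + 1" n] by (simp add: Suc_diff_le)
  have "Suc n * ((2 * Suc n) choose Suc n) = 2 * (Suc n * ((2 * n + 1) choose n))"
    using 1 by (simp only: mult.commute) (simp add: algebra_simps)
  then show ?thesis
    using 2 by simp
qed

lemma central_Suc: "2 * of_nat (Suc n) * central (Suc n) = of_nat (2 * n + 1) * central n"
proof -
  have "of_nat (Suc n) * of_nat ((2 * Suc n) choose Suc n)
      = 2 * of_nat (2 * n + 1) * (of_nat ((2 * n) choose n) :: rat)"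
    using arg_cong[OF central_binomial_Suc[of n], of "of_nat :: nat \<Rightarrow> rat"]
    by (simp only: of_nat_mult of_nat_numeral)
  then have "2 * of_nat (Suc n) * central (Suc n)
      = 2 * (2 * of_nat (2 * n + 1) * of_nat ((2 * n) choose n)) / 4 ^ Suc n"
    by (simp only: central_def times_divide_eq_right mult.assoc)
  also have "\<dots> = of_nat (2 * n + 1) * central n"
    by (simp only: central_def power_Suc) (simp only: field_simps, simp)
  finally show ?thesis .
qed

section \<open>Alternating binomial sums and the Apery operator\<close>

text \<open>With \<open>E\<close> the shift of sequences, this is \<open>(1 - E) ^ n\<close> applied
  to \<open>a\<close> and evaluated at \<open>0\<close>.\<close>

definition altbinom_sum :: "(nat \<Rightarrow> rat) \<Rightarrow> nat \<Rightarrow> rat" where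
  "altbinom_sum a n = (\<Sum>k\<le>n. (-1) ^ k * of_nat (n choose k) * a k)"

text \<open>Serves to bring the sums for \<open>m\<close>, \<open>m + 1\<close> and
  \<open>m + 2\<close> to one common range.\<close>

lemma altbinom_sum_extend:
  assumes "n \<le> N"
  shows "altbinom_sum a n = (\<Sum>k\<le>N. (-1) ^ k * of_nat (n choose k) * a k)"
  unfolding altbinom_sum_def using assms by (intro sum.mono_neutral_left) auto

text \<open>Pascal's rule and absorption express every coefficient through the entries
  \<open>x\<close> and \<open>y\<close> of row \<open>m + 1\<close>, which satisfy
  \<open>(k + 1) x = (m + 1 - k) y\<close>; a polynomial identity remains. On the right,
  \<open>m\<close> enters only through the row, so the operator can be moved onto the coefficients
  \<open>a\<close>.\<close>

lemma apery_operator_binomial: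
  "4 * of_nat (m + 2) ^ 2 * of_nat ((m + 2) choose Suc k)
    - (8 * of_nat (m + 2) ^ 2 - 8 * of_nat (m + 2) + 3) * of_nat ((m + 1) choose Suc k)
    + 4 * (of_nat (m + 2) - 1) ^ 2 * of_nat (m choose Suc k)
   = of_nat (2 * Suc k + 1) ^ 2 * of_nat ((m + 1) choose Suc k)
     + 4 * of_nat (Suc k) ^ 2 * (of_nat ((m + 1) choose k) :: rat)"
proof -
  define x y M K where "x = (of_nat ((m + 1) choose Suc k) :: rat)"
    and "y = (of_nat ((m + 1) choose k) :: rat)" and "M = (of_nat m :: rat)" and "K = (of_nat k :: rat)"
  have 1: "of_nat ((m + 2) choose Suc k) = x + y"
    by (simp add: x_def y_def)
  have abs: "(M + 1) * of_nat (m choose Suc k) = (M - K) * x"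
  proof (cases "Suc k \<le> m + 1")
    case True
    then have "of_nat (m + 1 - Suc k) * x = (M + 1) * of_nat (m choose Suc k)"
      using arg_cong[OF binomial_absorb_comp[of "m + 1" "Suc k"], of "of_nat :: nat \<Rightarrow> rat"]
      unfolding x_def M_def by (simp only: of_nat_mult) simp
    with True show ?thesis by (simp add: M_def K_def of_nat_diff)
  next
    case False
    then show ?thesis by (simp add: x_def binomial_eq_0)
  qed
  have xy: "(K + 1) * x = (M + 1 - K) * y"
  proof (cases "k \<le> m + 1")
    case True
    then have "(K + 1) * x = of_nat (m + 1 - k) * y"
      using arg_cong[OF binomial_absorption[of k "m + 1"], of "of_nat :: nat \<Rightarrow> rat"]
        arg_cong[OF binomial_absorb_comp[of "m + 1" k], of "of_nat :: nat \<Rightarrow> rat"]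
      unfolding x_def y_def K_def by (simp only: of_nat_mult) (simp add: algebra_simps)
    with True show ?thesis by (simp add: M_def K_def of_nat_diff)
  qed (simp add: x_def y_def binomial_eq_0)
  have "4 * (M + 2) ^ 2 * (x + y) - (8 * (M + 2) ^ 2 - 8 * (M + 2) + 3) * x
      + 4 * (M + 1) * ((M - K) * x) = (2 * K + 3) ^ 2 * x + 4 * (K + 1) ^ 2 * y"
    using xy by algebra
  then have "4 * (M + 2) ^ 2 * (x + y) - (8 * (M + 2) ^ 2 - 8 * (M + 2) + 3) * x
      + 4 * (M + 1) ^ 2 * of_nat (m choose Suc k) = (2 * K + 3) ^ 2 * x + 4 * (K + 1) ^ 2 * y"
    unfolding abs[symmetric] by (simp add: power2_eq_square mult_ac)
  then show ?thesis
    unfolding 1 x_def[symmetric] y_def[symmetric] by (simp add: M_def K_def algebra_simps)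
qed

text \<open>Summation by parts: shifting \<open>k\<close> by one in the second term of
  \<open>apery_operator_binomial\<close> turns the second-order operator in \<open>n\<close> into a
  first-order operator on \<open>a\<close>. The homogeneous recurrence thus reduces to a two-term
  relation between \<open>a k\<close> and \<open>a (Suc k)\<close>.\<close>

lemma apery_operator_altbinom_sum:
  "4 * of_nat (m + 2) ^ 2 * altbinom_sum a (m + 2)
    - (8 * of_nat (m + 2) ^ 2 - 8 * of_nat (m + 2) + 3) * altbinom_sum a (m + 1)
    + 4 * (of_nat (m + 2) - 1) ^ 2 * altbinom_sum a m
   = altbinom_sum (\<lambda>k. of_nat (2 * k + 1) ^ 2 * a k - 4 * of_nat (Suc k) ^ 2 * a (Suc k)) (m + 1)"
    (is "?L = ?R")
proof -
  let ?b = "\<lambda>k. (-1) ^ k * a k"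
  let ?P = "\<lambda>k. 4 * of_nat (m + 2) ^ 2 * of_nat ((m + 2) choose k)
    - (8 * of_nat (m + 2) ^ 2 - 8 * of_nat (m + 2) + 3) * of_nat ((m + 1) choose k)
    + 4 * (of_nat (m + 2) - 1) ^ 2 * (of_nat (m choose k) :: rat)"
  let ?Q = "\<lambda>k. of_nat (2 * k + 1) ^ 2 * (of_nat ((m + 1) choose k) :: rat)"
  let ?S = "\<lambda>k. 4 * of_nat (Suc k) ^ 2 * (of_nat ((m + 1) choose k) :: rat)"
  \<comment> \<open>At \<open>k = 0\<close> there is no coefficient with index \<open>k - 1\<close>;
    both sides equal 1.\<close>
  have P0: "?P 0 = ?Q 0"
    by (simp add: power2_eq_square algebra_simps)
  have m1: "altbinom_sum a (m + 1) = (\<Sum>k\<le>m + 2. (-1) ^ k * of_nat ((m + 1) choose k) * a k)"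
    by (rule altbinom_sum_extend) simp
  have "?L = (\<Sum>k\<le>m + 2. ?b k * ?P k)"
    unfolding altbinom_sum_extend[of m "m + 2" a, OF le_add1] m1
      altbinom_sum_extend[of "m + 2" "m + 2" a, OF order.refl]
      sum_distrib_left sum_subtractf[symmetric] sum.distrib[symmetric]
    by (intro sum.cong refl) (simp add: algebra_simps)
  also have "\<dots> = ?b 0 * ?P 0 + (\<Sum>k\<le>m + 1. ?b (Suc k) * ?P (Suc k))"
    using sum.atMost_Suc_shift[of "\<lambda>k. ?b k * ?P k" "m + 1"] by (simp only: add_Suc_right[symmetric] Suc_1 Suc_eq_plus1) simp
  also have "\<dots> = ?b 0 * ?Q 0 + (\<Sum>k\<le>m + 1. ?b (Suc k) * (?Q (Suc k) + ?S k))"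
    unfolding P0 apery_operator_binomial ..
  also have "\<dots> = (?b 0 * ?Q 0 + (\<Sum>k\<le>m + 1. ?b (Suc k) * ?Q (Suc k))) + (\<Sum>k\<le>m + 1. ?b (Suc k) * ?S k)"
    by (simp only: distrib_left sum.distrib add.assoc)
  also have "?b 0 * ?Q 0 + (\<Sum>k\<le>m + 1. ?b (Suc k) * ?Q (Suc k)) = (\<Sum>k\<le>Suc (m + 1). ?b k * ?Q k)"
    by (rule sum.atMost_Suc_shift[symmetric])
  also have "\<dots> = (\<Sum>k\<le>m + 1. ?b k * ?Q k)"
    by (subst sum.atMost_Suc) (simp add: binomial_eq_0)
  also have "(\<Sum>k\<le>m + 1. ?b k * ?Q k) + (\<Sum>k\<le>m + 1. ?b (Suc k) * ?S k) = ?R"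
    unfolding altbinom_sum_def sum.distrib[symmetric]
    by (intro sum.cong refl) (simp add: algebra_simps)
  finally show ?thesis .
qed

text \<open>Partial fractions of \<open>n! / (x (x + 1) ... (x + n))\<close>. Pascal's rule writes
  the sum for \<open>Suc n\<close> as the difference of the sums for \<open>n\<close> at
  \<open>x\<close> and at \<open>x + 1\<close>. The case \<open>x = 1 / 2\<close> gives the
  inhomogeneity of \<open>Jt3\<close>, the case \<open>x = j + 1\<close> the denominators of
  \<open>1 / central j\<close>.\<close>

lemma altbinom_sum_inverse_shift:
  assumes "x > 0"
  shows "altbinom_sum (\<lambda>k. 1 / (x + of_nat k)) n = fact n / pochhammer x (Suc n)"
  using assms
proof (induction n arbitrary: x)
  case 0
  then show ?case by (simp add: altbinom_sum_def)
next
  case (Suc n)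
  let ?f = "\<lambda>x k. (1 :: rat) / (x + of_nat k)"
  have "altbinom_sum (?f x) (Suc n) = altbinom_sum (?f x) n - altbinom_sum (?f (x + 1)) n"
  proof -
    let ?c = "\<lambda>k. (-1) ^ k * of_nat (n choose k) :: rat"
    have "altbinom_sum (?f x) (Suc n)
        = ?f x 0 + (\<Sum>k\<le>n. (-1) ^ Suc k * of_nat (Suc n choose Suc k) * ?f x (Suc k))"
      unfolding altbinom_sum_def by (subst sum.atMost_Suc_shift) simp
    also have "\<dots> = ?f x 0 + (\<Sum>k\<le>n. ?c (Suc k) * ?f x (Suc k) - ?c k * ?f (x + 1) k)"
      by (intro arg_cong2[of _ _ _ _ "(+)"] refl sum.cong)
        (simp_all add: algebra_simps add_divide_distrib diff_divide_distrib)
    also have "\<dots> = (?f x 0 + (\<Sum>k\<le>n. ?c (Suc k) * ?f x (Suc k))) - altbinom_sum (?f (x + 1)) n"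
      by (simp add: sum_subtractf altbinom_sum_def)
    also have "?f x 0 + (\<Sum>k\<le>n. ?c (Suc k) * ?f x (Suc k)) = (\<Sum>k\<le>Suc n. ?c k * ?f x k)"
      by (subst sum.atMost_Suc_shift) simp
    also have "\<dots> = altbinom_sum (?f x) n"
      by (simp add: altbinom_sum_def)
    finally show ?thesis .
  qed
  also have "\<dots> = fact n / pochhammer x (Suc n) - fact n / pochhammer (x + 1) (Suc n)"
    using Suc by simp
  also have "\<dots> = fact (Suc n) / pochhammer x (Suc (Suc n))"
  proof -
    define P where "P = pochhammer (x + 1) n"
    have P: "P > 0" unfolding P_def using Suc.prems by (intro pochhammer_pos) simp
    have "pochhammer x (Suc n) = x * P" "pochhammer (x + 1) (Suc n) = (x + 1 + of_nat n) * P"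
      "pochhammer x (Suc (Suc n)) = x * ((x + 1 + of_nat n) * P)"
      by (simp_all add: P_def pochhammer_rec[of x] pochhammer_rec'[of "x + 1"])
    moreover have "x + 1 + of_nat n > 0" using Suc.prems by (simp add: add_pos_nonneg)
    ultimately show ?thesis using P Suc.prems
      by (simp add: divide_simps) (simp add: algebra_simps)
  qed
  finally show ?case .
qed

section \<open>Matching the coefficients with the two recurrences\<close>

lemma odd_double_fact_Suc: "odd_double_fact (Suc n) = (2 * n + 1) * odd_double_fact n"
  by (simp add: odd_double_fact_def)

text \<open>Turns the inhomogeneity \<open>2 ^ n (n - 1)! / (2 n - 1)!!\<close> into
  \<open>(n - 1)! / pochhammer (1 / 2) n\<close>, the value of a partial fraction sum.\<close>

lemma odd_double_fact_pochhammer: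
  "of_nat (odd_double_fact n) = 2 ^ n * pochhammer (1 / 2 :: rat) n"
proof (induction n)
  case 0
  then show ?case by (simp add: odd_double_fact_def)
next
  case (Suc n)
  then show ?case
    by (simp add: odd_double_fact_Suc pochhammer_rec' algebra_simps)
qed

definition inv_central_sum :: "nat \<Rightarrow> rat" where
  "inv_central_sum k = (\<Sum>j<k. 1 / (of_nat (2 * j + 1) ^ 3 * central j ^ 2))"

text \<open>Says that \<open>central k ^ 2\<close> is annihilated by the first-order operator of
  \<open>apery_operator_altbinom_sum\<close>.\<close>

lemma central_sq_Suc:
  "4 * of_nat (Suc k) ^ 2 * central (Suc k) ^ 2 = of_nat (2 * k + 1) ^ 2 * central k ^ 2"
  using arg_cong[OF central_Suc[of k], of "\<lambda>x. x ^ 2"] by (simp only: power_mult_distrib) simp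

lemma Jt2_closed: "Jt2 n = altbinom_sum (\<lambda>k. central k ^ 2) n"
proof (induction n rule: Jt2.induct)
  case 1
  then show ?case by (simp add: altbinom_sum_def)
next
  case 2
  then show ?case by (simp add: altbinom_sum_def central_def power2_eq_square)
next
  case (3 k)
  let ?F = "altbinom_sum (\<lambda>k. central k ^ 2)"
  have "4 * of_nat (k + 2) ^ 2 * ?F (k + 2)
    - (8 * of_nat (k + 2) ^ 2 - 8 * of_nat (k + 2) + 3) * ?F (k + 1)
    + 4 * (of_nat (k + 2) - 1) ^ 2 * ?F k = 0"
    unfolding apery_operator_altbinom_sum central_sq_Suc by (simp add: altbinom_sum_def)
  moreover have "4 * of_nat (k + 2) ^ 2 * Jt2 (k + 2)
    - (8 * of_nat (k + 2) ^ 2 - 8 * of_nat (k + 2) + 3) * ?F (k + 1)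
    + 4 * (of_nat (k + 2) - 1) ^ 2 * ?F k = 0"
    using Jt2_recurrence[of "k + 2"] 3 by simp
  ultimately have "4 * of_nat (k + 2) ^ 2 * Jt2 (k + 2) = 4 * of_nat (k + 2) ^ 2 * ?F (k + 2)"
    by linarith
  moreover have "4 * (of_nat (k + 2) :: rat) ^ 2 \<noteq> 0"
    by (simp only: mult_eq_0_iff power_eq_0_iff of_nat_eq_0_iff) simp
  ultimately have "Jt2 (k + 2) = ?F (k + 2)"
    using mult_left_cancel by blast
  then show ?case by simp
qed

text \<open>Variation of constants: on the solution \<open>central k ^ 2\<close> times a varying
  factor, only the increment of that factor survives. The summands of \<open>inv_central_sum\<close>
  are chosen so that this leaves \<open>2 / (2 j + 1) = 1 / (1 / 2 + j)\<close>, whose alternating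
  sum is the required inhomogeneity.\<close>

lemma Jt3_closed: "Jt3 n = altbinom_sum (\<lambda>k. - 2 * (central k ^ 2 * inv_central_sum k)) n"
proof (induction n rule: Jt3.induct)
  case 1
  then show ?case by (simp add: altbinom_sum_def inv_central_sum_def)
next
  case 2
  then show ?case by (simp add: altbinom_sum_def central_def inv_central_sum_def power2_eq_square)
next
  case (3 k)
  let ?a = "\<lambda>k. - 2 * (central k ^ 2 * inv_central_sum k)"
  let ?F = "altbinom_sum ?a"
  have step: "of_nat (2 * j + 1) ^ 2 * ?a j - 4 * of_nat (Suc j) ^ 2 * ?a (Suc j)
      = 1 / (1 / 2 + of_nat j)" for j
  proof -
    have "of_nat (2 * j + 1) ^ 2 * ?a j - 4 * of_nat (Suc j) ^ 2 * ?a (Suc j)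
      = 2 * ((4 * of_nat (Suc j) ^ 2 * central (Suc j) ^ 2) * inv_central_sum (Suc j)
         - of_nat (2 * j + 1) ^ 2 * central j ^ 2 * inv_central_sum j)"
      by (simp add: algebra_simps)
    also have "\<dots> = 2 * (of_nat (2 * j + 1) ^ 2 * central j ^ 2
        * (1 / (of_nat (2 * j + 1) ^ 3 * central j ^ 2)))"
      unfolding central_sq_Suc by (simp add: inv_central_sum_def algebra_simps)
    also have "\<dots> = 2 / of_nat (2 * j + 1)"
      using central_pos[of j] by (simp add: power3_eq_cube power2_eq_square del: of_nat_Suc of_nat_add of_nat_mult)
    also have "\<dots> = 1 / (1 / 2 + of_nat j)"
      by (simp add: divide_simps)
    finally show ?thesis .
  qed
  have "4 * of_nat (k + 2) ^ 2 * ?F (k + 2)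
    - (8 * of_nat (k + 2) ^ 2 - 8 * of_nat (k + 2) + 3) * ?F (k + 1)
    + 4 * (of_nat (k + 2) - 1) ^ 2 * ?F k = fact (k + 1) / pochhammer (1 / 2) (k + 2)"
    unfolding apery_operator_altbinom_sum step
    by (subst altbinom_sum_inverse_shift) simp_all
  moreover have "4 * of_nat (k + 2) ^ 2 * Jt3 (k + 2)
    - (8 * of_nat (k + 2) ^ 2 - 8 * of_nat (k + 2) + 3) * ?F (k + 1)
    + 4 * (of_nat (k + 2) - 1) ^ 2 * ?F k = fact (k + 1) / pochhammer (1 / 2) (k + 2)"
    using Jt3_recurrence[of "k + 2"] 3 by (simp add: odd_double_fact_pochhammer)
  ultimately have "4 * of_nat (k + 2) ^ 2 * Jt3 (k + 2) = 4 * of_nat (k + 2) ^ 2 * ?F (k + 2)"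
    by linarith
  moreover have "4 * (of_nat (k + 2) :: rat) ^ 2 \<noteq> 0"
    by (simp only: mult_eq_0_iff power_eq_0_iff of_nat_eq_0_iff) simp
  ultimately have "Jt3 (k + 2) = ?F (k + 2)"
    using mult_left_cancel by blast
  then show ?case by simp
qed

section \<open>Binomial coefficients modulo prime powers\<close>

lemma diff_dvd_power_diff: "x - y dvd x ^ n - (y :: 'a :: comm_ring_1) ^ n"
  by (cases n) (simp_all only: diff_power_eq_sum dvd_triv_left, simp)

lemma power_congruence_step:
  fixes x y :: "'a :: comm_ring_1"
  assumes "of_nat p ^ Suc t dvd x - y" "p > 0"
  shows "of_nat p ^ Suc (Suc t) dvd x ^ p - y ^ p"
proof -
  obtain n where n: "p = Suc n" using assms(2) by (cases p) auto
  have p: "of_nat p dvd x - y"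
    using assms(1) by (rule dvd_trans[rotated]) simp
  \<comment> \<open>Modulo \<open>p\<close> each of the \<open>p\<close> summands equals
    \<open>y ^ n\<close>, so the cofactor of \<open>x - y\<close> is divisible by
    \<open>p\<close>.\<close>
  have "(\<Sum>q<p. x ^ q * y ^ (n - q)) = (\<Sum>q<p. (x ^ q - y ^ q) * y ^ (n - q)) + (\<Sum>q<p. y ^ n)"
    unfolding sum.distrib[symmetric]
    by (intro sum.cong refl) (simp add: n algebra_simps power_add[symmetric])
  moreover have "of_nat p dvd (\<Sum>q<p. (x ^ q - y ^ q) * y ^ (n - q))"
    using p diff_dvd_power_diff by (intro dvd_sum dvd_mult2) (rule dvd_trans)
  ultimately have "of_nat p dvd (\<Sum>q<p. x ^ q * y ^ (n - q))"
    by simp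
  then have "of_nat p ^ Suc t * of_nat p dvd (x - y) * (\<Sum>q<p. x ^ q * y ^ (n - q))"
    using assms(1) by (intro mult_dvd_mono)
  then show ?thesis
    unfolding n diff_power_eq_sum by (simp only: power_Suc mult_ac)
qed

text \<open>Stated over a commutative ring because it is applied both to \<open>int poly\<close>,
  for binomial coefficients, and to \<open>int\<close>, for powers of 4.\<close>

lemma power_prime_power_congruence:
  fixes x y :: "'a :: comm_ring_1"
  assumes "of_nat p dvd x - y" "p > 0"
  shows "of_nat p ^ Suc t dvd x ^ (p ^ t * m) - y ^ (p ^ t * m)"
proof -
  have "of_nat p ^ Suc t dvd x ^ (p ^ t) - y ^ (p ^ t)"
  proof (induction t)
    case (Suc t)
    then show ?case
      using power_congruence_step[OF Suc assms(2)] by (simp only: power_Suc2 power_mult)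
  qed (use assms in simp)
  then show ?thesis
    unfolding power_mult using diff_dvd_power_diff dvd_trans by blast
qed

lemma coeff_one_plus_X_power: "coeff ([:1, 1:] ^ n) k = (of_nat (n choose k) :: int)"
proof (cases "k \<le> n")
  case True
  then show ?thesis by (simp add: coeff_linear_poly_power)
next
  case False
  have "degree ([:1, 1:: int:] ^ n) \<le> n"
    using degree_power_le[of "[:1, 1 :: int:]" n] by simp
  with False show ?thesis by (simp add: coeff_eq_0)
qed

lemma coeff_one_plus_X_power_power:
  assumes "p > 0"
  shows "coeff ((monom 1 p + 1) ^ n) k = (if p dvd k then of_nat (n choose (k div p)) else 0 :: int)"
proof -
  have "coeff ((monom 1 p + 1) ^ n) k
      = (\<Sum>j\<le>n. of_nat (n choose j) * (if p * j = k then 1 else 0 :: int))"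
    by (simp add: binomial_ring coeff_sum monom_power of_nat_poly)
  also have "\<dots> = (if p dvd k then of_nat (n choose (k div p)) else 0)"
  proof (cases "p dvd k")
    case True
    then obtain i where i: "k = p * i" ..
    have "(\<Sum>j\<le>n. of_nat (n choose j) * (if p * j = k then 1 else 0 :: int))
        = (\<Sum>j\<le>n. if j = i then of_nat (n choose j) else 0)"
      using assms by (intro sum.cong) (auto simp: i)
    then show ?thesis using assms by (simp add: i)
  next
    case False
    then have "p * j \<noteq> k" for j by auto
    then show ?thesis using False by simp
  qed
  finally show ?thesis .
qed

text \<open>The inner coefficients of the \<open>p\<close>-th power are binomials
  \<open>p choose k\<close> with \<open>0 < k < p\<close>, all divisible by
  \<open>p\<close>.\<close>

lemma one_plus_X_power_prime:
  assumes "prime p"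
  shows "of_nat p dvd [:1, 1:] ^ p - (monom 1 p + 1 :: int poly)"
proof -
  have "int p dvd coeff ([:1, 1:] ^ p - (monom 1 p + 1)) k" for k
  proof (cases "0 < k \<and> k < p")
    case True
    then have "p dvd (p choose k)"
      using assms by (intro dvd_choose_prime) auto
    then show ?thesis using True by (simp add: coeff_one_plus_X_power)
  next
    case False
    then have "k = 0 \<or> k = p \<or> k > p" by auto
    moreover have "p > 0" using assms by (rule prime_gt_0_nat)
    ultimately show ?thesis by (auto simp: coeff_one_plus_X_power binomial_eq_0)
  qed
  then show ?thesis
    unfolding of_nat_poly const_poly_dvd_iff by simp
qed

text \<open>Comparison of the coefficients of \<open>X ^ k\<close> in \<open>(1 + X) ^ (p n)\<close>
  and \<open>(1 + X ^ p) ^ n\<close> for \<open>n = p ^ s m\<close>.\<close>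

lemma binomial_prime_power_congruence:
  assumes "prime p"
  shows "int p ^ Suc s dvd int ((p * (p ^ s * m)) choose k)
      - (if p dvd k then int ((p ^ s * m) choose (k div p)) else 0)"
proof -
  have p: "p > 0" using assms by (rule prime_gt_0_nat)
  have "of_nat p ^ Suc s dvd ([:1, 1:] ^ p) ^ (p ^ s * m) - (monom 1 p + 1 :: int poly) ^ (p ^ s * m)"
    by (intro power_prime_power_congruence one_plus_X_power_prime assms p)
  then have "[:int p ^ Suc s:] dvd [:1, 1:] ^ (p * (p ^ s * m)) - (monom 1 p + 1 :: int poly) ^ (p ^ s * m)"
    by (simp only: power_mult of_nat_poly poly_const_pow)
  then have "int p ^ Suc s dvd coeff ([:1, 1:] ^ (p * (p ^ s * m)) - (monom 1 p + 1) ^ (p ^ s * m)) k"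
    unfolding const_poly_dvd_iff ..
  then show ?thesis
    unfolding coeff_diff coeff_one_plus_X_power coeff_one_plus_X_power_power[OF p] .
qed

text \<open>Evaluating \<open>one_plus_X_power_prime\<close> at 1 gives Fermat's congruence for 2,
  and \<open>2 ^ p - 2\<close> divides \<open>4 ^ p - 4\<close>.\<close>

lemma prime_dvd_four_power_diff:
  assumes "prime p"
  shows "int p dvd 4 ^ p - 4"
proof -
  obtain R where "[:1, 1:] ^ p - (monom 1 p + 1 :: int poly) = of_nat p * R"
    using one_plus_X_power_prime[OF assms] ..
  then have "poly ([:1, 1:] ^ p - (monom 1 p + 1 :: int poly)) 1 = poly (of_nat p * R) 1"
    by simp
  then have "(2 :: int) ^ p - 2 = int p * poly R 1"
    by (simp add: poly_monom)
  moreover have "(4 :: int) ^ p - 4 = (2 ^ p - 2) * (2 ^ p + 2)"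
    by (simp add: algebra_simps power_mult_distrib[symmetric])
  ultimately show ?thesis by simp
qed

text \<open>Cancel \<open>p ^ t\<close> in
  \<open>k (n choose k) = n ((n - 1) choose (k - 1))\<close>. Truncated subtraction makes the claim
  trivial for \<open>t > s\<close>.\<close>

lemma prime_power_dvd_binomial:
  fixes p u :: nat
  assumes "prime p" "\<not> p dvd u"
  shows "p ^ (s - t) dvd ((p ^ s * m) choose (p ^ t * u))"
proof (cases "t \<le> s")
  case True
  let ?n = "p ^ s * m" and ?k = "p ^ t * u"
  have "?k > 0" using assms by (auto simp: prime_gt_0_nat intro: Nat.gr0I)
  then have "?k * (?n choose ?k) = ?n * ((?n - 1) choose (?k - 1))"
    by (rule times_binomial_minus1_eq)
  then have "p ^ t * (u * (?n choose ?k)) = p ^ t * (p ^ (s - t) * (m * ((?n - 1) choose (?k - 1))))"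
    using le_add_diff_inverse[OF True] by (simp only: power_add[symmetric] mult.assoc[symmetric])
  then have "p ^ (s - t) dvd u * (?n choose ?k)"
    using assms(1) by (auto simp: prime_gt_0_nat)
  moreover have "coprime (p ^ (s - t)) u"
    using prime_imp_coprime[OF assms] by simp
  ultimately show ?thesis by (simp add: coprime_dvd_mult_right_iff)
qed simp

section \<open>Rationals integral at a prime\<close>

text \<open>The ideal generated by \<open>p ^ s\<close> in the integers localized at
  \<open>p\<close>. Coprimality is to \<open>p\<close> and not to \<open>p ^ s\<close>, so that
  level 0 still means integrality at \<open>p\<close>.\<close>

definition padic_ball :: "nat \<Rightarrow> nat \<Rightarrow> rat set" where
  "padic_ball p s = {x. \<exists>N D :: int. D \<noteq> 0 \<and> coprime D (int p) \<and> x = of_nat p ^ s * of_int N / of_int D}"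

lemma padic_ballI:
  assumes "x = of_nat p ^ s * of_int N / of_int D" "D \<noteq> 0" "coprime D (int p)"
  shows "x \<in> padic_ball p s"
  unfolding padic_ball_def using assms by blast

lemma padic_ballE:
  assumes "x \<in> padic_ball p s"
  obtains N D where "x = of_nat p ^ s * of_int N / of_int D" "D \<noteq> 0" "coprime D (int p)"
  using assms unfolding padic_ball_def by blast

lemma rat_cong_padic_ball:
  assumes "x - y \<in> padic_ball p r"
  shows "[x \<equiv> y] (rmod p ^ r)"
  using assms unfolding padic_ball_def rat_cong_def by auto

lemma padic_ball_add:
  assumes "x \<in> padic_ball p s" "y \<in> padic_ball p s"
  shows "x + y \<in> padic_ball p s"
proof -
  obtain N D where x: "x = of_nat p ^ s * of_int N / of_int D" "D \<noteq> 0" "coprime D (int p)"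
    using assms(1) by (rule padic_ballE)
  obtain N' D' where y: "y = of_nat p ^ s * of_int N' / of_int D'" "D' \<noteq> 0" "coprime D' (int p)"
    using assms(2) by (rule padic_ballE)
  have "x + y = of_nat p ^ s * of_int (N * D' + N' * D) / of_int (D * D')"
    using x y by (simp add: field_simps)
  then show ?thesis by (rule padic_ballI) (use x y in simp_all)
qed

lemma padic_ball_mult:
  assumes "x \<in> padic_ball p s" "y \<in> padic_ball p t"
  shows "x * y \<in> padic_ball p (s + t)"
proof -
  obtain N D where x: "x = of_nat p ^ s * of_int N / of_int D" "D \<noteq> 0" "coprime D (int p)"
    using assms(1) by (rule padic_ballE)
  obtain N' D' where y: "y = of_nat p ^ t * of_int N' / of_int D'" "D' \<noteq> 0" "coprime D' (int p)"
    using assms(2) by (rule padic_ballE)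
  have "x * y = of_nat p ^ (s + t) * of_int (N * N') / of_int (D * D')"
    using x(1) y(1) by (simp add: power_add mult_ac)
  then show ?thesis by (rule padic_ballI) (use x y in simp_all)
qed

lemma padic_ball_antimono:
  assumes "x \<in> padic_ball p t" "s \<le> t"
  shows "x \<in> padic_ball p s"
proof -
  obtain N D where x: "x = of_nat p ^ t * of_int N / of_int D" "D \<noteq> 0" "coprime D (int p)"
    using assms(1) by (rule padic_ballE)
  have "of_nat p ^ t = (of_nat p ^ s * of_int (int p ^ (t - s)) :: rat)"
    using assms(2) by (simp add: power_add[symmetric])
  then have "x = of_nat p ^ s * of_int (int p ^ (t - s) * N) / of_int D"
    using x(1) by simp
  then show ?thesis using x(2,3) by (rule padic_ballI)
qed

lemma padic_ball_of_int:
  assumes "int p ^ s dvd k"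
  shows "of_int k \<in> padic_ball p s"
proof -
  obtain N where "k = int p ^ s * N" using assms ..
  then have "of_int k = of_nat p ^ s * of_int N / (of_int 1 :: rat)" by simp
  then show ?thesis by (rule padic_ballI) simp_all
qed

lemma padic_ball_of_nat: "of_nat n \<in> padic_ball p 0"
  using padic_ball_of_int[of p 0 "int n"] by simp

lemma padic_ball_zero: "0 \<in> padic_ball p s"
  using padic_ball_of_int[of p s 0] by simp

lemma padic_ball_divide:
  assumes "x \<in> padic_ball p s" "D \<noteq> 0" "coprime D (int p)"
  shows "x / of_int D \<in> padic_ball p s"
proof -
  have "1 / of_int D \<in> padic_ball p 0"
    using assms(2,3) by (intro padic_ballI[of _ _ _ 1 D]) simp_all
  from padic_ball_mult[OF assms(1) this] show ?thesis by simp
qed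

lemma padic_ball_mult_integral:
  assumes "x \<in> padic_ball p 0" "y \<in> padic_ball p s"
  shows "x * y \<in> padic_ball p s" "y * x \<in> padic_ball p s"
  using padic_ball_mult[OF assms] by (simp_all add: mult.commute)

lemma padic_ball_sign: "x \<in> padic_ball p s \<Longrightarrow> (-1) ^ k * x \<in> padic_ball p s"
  using padic_ball_mult_integral(1)[OF padic_ball_of_int[of p 0 "(-1) ^ k"]] by simp

lemma padic_ball_power: "x \<in> padic_ball p 0 \<Longrightarrow> x ^ n \<in> padic_ball p 0"
  by (induction n) (use padic_ball_of_nat[of 1] in \<open>auto intro: padic_ball_mult_integral\<close>)

lemma padic_ball_sum: "(\<And>i. i \<in> A \<Longrightarrow> f i \<in> padic_ball p s) \<Longrightarrow> sum f A \<in> padic_ball p s"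
  by (induction A rule: infinite_finite_induct) (auto intro: padic_ball_add padic_ball_zero)

lemma prime_decompose:
  fixes d :: nat
  assumes "prime p" "d > 0"
  obtains t u where "d = p ^ t * u" "\<not> p dvd u"
  using multiplicity_decompose'[of d p] assms by (metis mult.commute neq0_conv not_prime_unit)

lemma padic_ball_prime_power_divide:
  assumes "prime p" "\<not> p dvd u" "t \<le> r"
  shows "of_nat p ^ r / of_nat (p ^ t * u) \<in> padic_ball p (r - t)"
proof -
  have "of_int (int p ^ (r - t)) / of_int (int u) \<in> padic_ball p (r - t)"
    using assms by (intro padic_ball_divide padic_ball_of_int)
      (auto simp: coprime_commute[of u] prime_imp_coprime intro: Nat.gr0I)
  also have "of_int (int p ^ (r - t)) / of_int (int u) = (of_nat p ^ r / of_nat (p ^ t * u) :: rat)"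
    using prime_gt_0_nat[OF assms(1)] power_add[of "of_nat p :: rat" t "r - t"] assms(3) by simp
  finally show ?thesis .
qed

lemma prime_power_le_exponent:
  fixes p :: nat
  assumes "prime p" "p ^ t * u < p ^ Suc r" "\<not> p dvd u"
  shows "t \<le> r"
proof -
  have "u > 0" using assms(3) by (auto intro: Nat.gr0I)
  then have "p ^ t \<le> p ^ t * u" by simp
  then have "p ^ t < p ^ Suc r" using assms(2) by linarith
  then have "t < Suc r"
    using prime_gt_1_nat[OF assms(1)] power_less_imp_less_exp by blast
  then show ?thesis by simp
qed

text \<open>Such a \<open>d\<close> has \<open>p\<close>-adic valuation at most \<open>r\<close>.
  The bound \<open>p ^ Suc r\<close> leaves room for \<open>d = 2 j + 1\<close> with
  \<open>j < p ^ r\<close>.\<close>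

lemma padic_ball_prime_power_divide_small:
  assumes "prime p" "0 < d" "d < p ^ Suc r"
  shows "of_nat p ^ r / of_nat d \<in> padic_ball p 0"
proof -
  obtain t u where "d = p ^ t * u" "\<not> p dvd u"
    using prime_decompose assms(1,2) by blast
  with assms show ?thesis
    using padic_ball_prime_power_divide[of p u t r] prime_power_le_exponent[of p t u r]
    by (auto intro: padic_ball_antimono)
qed

section \<open>Alternating sums with weight \<open>central k ^ 2\<close> at an odd prime\<close>

locale odd_prime =
  fixes p :: nat
  assumes prime: "prime p" and odd: "odd p"
begin

lemma pos: "p > 0" and gt_2: "p > 2"
  using prime odd prime_ge_2_nat[OF prime] by (auto simp: prime_gt_0_nat le_less)

lemma coprime_four_power: "coprime (4 ^ k) (int p)"
proof -
  have "coprime (int 2) (int p)"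
    using odd unfolding coprime_int_iff by simp
  then have "coprime ((int 2) ^ (2 * k)) (int p)" by simp
  then show ?thesis by (simp only: power_mult) simp
qed

lemma central_integral: "central k \<in> padic_ball p 0"
  using padic_ball_divide[OF padic_ball_of_nat _ coprime_four_power[of k], of "(2 * k) choose k"]
  by (simp add: central_def)

text \<open>Numerator and denominator are compared separately: the binomials by
  \<open>binomial_prime_power_congruence\<close> with \<open>m = 2 u\<close>, the powers of 4 by
  lifting Fermat's congruence.\<close>

lemma central_mult_prime: "central (p * (p ^ t * u)) - central (p ^ t * u) \<in> padic_ball p (Suc t)"
proof -
  define k where "k = p ^ t * u"
  define B C where "B = int ((2 * (p * k)) choose (p * k))" and "C = int ((2 * k) choose k)"
  have "int p ^ Suc t dvd B - C"
    using binomial_prime_power_congruence[OF prime, of t "2 * u" "p * k"] pos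
    by (simp add: B_def C_def k_def mult_ac)
  moreover have "int p ^ Suc t dvd 4 ^ (p * k) - 4 ^ k"
    using power_prime_power_congruence[OF prime_dvd_four_power_diff[OF prime] pos, of t u]
    by (simp add: power_mult k_def)
  moreover have "B * 4 ^ k - C * 4 ^ (p * k) = (B - C) * 4 ^ k - C * (4 ^ (p * k) - 4 ^ k)"
    by (simp add: algebra_simps)
  ultimately have "int p ^ Suc t dvd B * 4 ^ k - C * 4 ^ (p * k)"
    by (metis dvd_diff dvd_mult dvd_mult2)
  then have "of_int (B * 4 ^ k - C * 4 ^ (p * k)) / of_int (4 ^ (p * k + k)) \<in> padic_ball p (Suc t)"
    by (intro padic_ball_divide padic_ball_of_int coprime_four_power) simp_all
  also have "of_int (B * 4 ^ k - C * 4 ^ (p * k)) / of_int (4 ^ (p * k + k)) = central (p * k) - central k"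
    by (simp add: central_def B_def C_def power_add field_simps)
  finally show ?thesis by (simp add: k_def)
qed

text \<open>The two valuations compensate: for \<open>k = p ^ t u\<close> the difference of squares
  has only \<open>t + 1\<close> factors \<open>p\<close>, but the binomial supplies
  \<open>s - t\<close> more.\<close>

lemma binomial_central_sq_mult_prime:
  "of_nat ((p ^ s * m) choose k) * (central (p * k) ^ 2 - central k ^ 2) \<in> padic_ball p (Suc s)"
proof (cases "k = 0")
  case True
  then show ?thesis by (simp add: padic_ball_zero)
next
  case False
  then obtain t u where k: "k = p ^ t * u" "\<not> p dvd u"
    using prime_decompose prime by blast
  have "int p ^ (s - t) dvd int ((p ^ s * m) choose k)"
    using prime_power_dvd_binomial[OF prime k(2), of s t m] unfolding k(1)
    by (simp only: of_nat_power[symmetric] int_dvd_int_iff)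
  then have 1: "of_nat ((p ^ s * m) choose k) \<in> padic_ball p (s - t)"
    using padic_ball_of_int by fastforce
  have "(central (p * k) - central k) * (central (p * k) + central k) \<in> padic_ball p (Suc t)"
    using central_mult_prime[of t u] unfolding k(1)[symmetric]
    by (intro padic_ball_mult_integral padic_ball_add central_integral)
  then have 2: "central (p * k) ^ 2 - central k ^ 2 \<in> padic_ball p (Suc t)"
    by (simp add: power2_eq_square algebra_simps)
  \<comment> \<open>The exponent \<open>(s - t) + Suc t\<close> is at least \<open>Suc s\<close>
    also for \<open>t > s\<close>, by truncated subtraction.\<close>
  show ?thesis
    by (rule padic_ball_antimono[OF padic_ball_mult[OF 1 2]]) simp
qed

text \<open>Common core of both congruences: the weights are constantly 1 for \<open>Jt2\<close> and
  scaled partial sums for \<open>Jt3\<close>. Summands with \<open>p\<close> not dividing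
  \<open>k\<close> vanish through their binomial; the one at \<open>p k\<close> is matched with the
  one at \<open>k\<close>.\<close>

lemma altbinom_sum_central_congruence:
  assumes n: "n = p ^ s * m"
    and g: "\<And>k. k \<le> p * n \<Longrightarrow> g k \<in> padic_ball p 0"
    and g': "\<And>k. k \<le> n \<Longrightarrow> g' k \<in> padic_ball p 0"
    and gg': "\<And>k. k \<le> n \<Longrightarrow> g (p * k) - g' k \<in> padic_ball p (Suc s)"
  shows "altbinom_sum (\<lambda>k. central k ^ 2 * g k) (p * n)
      - altbinom_sum (\<lambda>k. central k ^ 2 * g' k) n \<in> padic_ball p (Suc s)"
proof -
  let ?f = "\<lambda>k. (-1) ^ k * of_nat ((p * n) choose k) * (central k ^ 2 * g k)"
  let ?f' = "\<lambda>k. (-1) ^ k * of_nat (n choose k) * (central k ^ 2 * g' k)"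
  have "altbinom_sum (\<lambda>k. central k ^ 2 * g k) (p * n)
      = sum ?f {k. k \<le> p * n \<and> p dvd k} + sum ?f {k. k \<le> p * n \<and> \<not> p dvd k}"
    unfolding altbinom_sum_def by (subst sum.union_disjoint[symmetric]) (auto intro!: sum.cong)
  moreover have "sum ?f {k. k \<le> p * n \<and> p dvd k} = (\<Sum>k\<le>n. ?f (p * k))"
    using pos by (intro sum.reindex_bij_witness[of _ "\<lambda>k. p * k" "\<lambda>k. k div p"])
      (auto simp: less_eq_div_iff_mult_less_eq elim!: dvdE)
  ultimately have eq: "altbinom_sum (\<lambda>k. central k ^ 2 * g k) (p * n)
      - altbinom_sum (\<lambda>k. central k ^ 2 * g' k) n
    = (\<Sum>k\<le>n. ?f (p * k) - ?f' k) + sum ?f {k. k \<le> p * n \<and> \<not> p dvd k}"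
    by (simp add: altbinom_sum_def sum_subtractf)
  have "?f k \<in> padic_ball p (Suc s)" if "k \<le> p * n" "\<not> p dvd k" for k
  proof -
    have "of_int (int ((p * n) choose k)) \<in> padic_ball p (Suc s)"
      using binomial_prime_power_congruence[OF prime, of s m k] that
      by (intro padic_ball_of_int) (simp add: n)
    then show ?thesis
      using that g central_integral
      by (simp add: mult.assoc) (intro padic_ball_sign padic_ball_mult_integral padic_ball_power; simp)
  qed
  moreover have "?f (p * k) - ?f' k \<in> padic_ball p (Suc s)" if k: "k \<le> n" for k
  proof -
    let ?C = "of_nat ((p * n) choose (p * k))" and ?C' = "of_nat (n choose k)"
    have sign: "(-1) ^ (p * k) = ((-1) ^ k :: rat)"
      using odd by (simp add: power_mult)
    \<comment> \<open>The difference of the two summands telescopes by exchanging first the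
      binomial, then the central square, then the weight.\<close>
    have "?C - ?C' \<in> padic_ball p (Suc s)"
      using binomial_prime_power_congruence[OF prime, of s m "p * k"] pos
      by (subst of_int_of_nat_eq[symmetric], subst (2) of_int_of_nat_eq[symmetric],
          subst of_int_diff[symmetric], intro padic_ball_of_int) (simp add: n)
    moreover have pk: "g (p * k) \<in> padic_ball p 0" using k by (intro g) simp
    ultimately have "(?C - ?C') * (central (p * k) ^ 2 * g (p * k)) \<in> padic_ball p (Suc s)"
      using central_integral by (intro padic_ball_mult_integral padic_ball_power)
    moreover have "?C' * (central (p * k) ^ 2 - central k ^ 2) * g (p * k) \<in> padic_ball p (Suc s)"
      using binomial_central_sq_mult_prime[of s m k] pk unfolding n by (rule padic_ball_mult_integral(2)[rotated])
    moreover have "?C' * central k ^ 2 * (g (p * k) - g' k) \<in> padic_ball p (Suc s)"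
      using gg'[OF k] central_integral by (intro padic_ball_mult_integral padic_ball_power padic_ball_of_nat)
    ultimately have "(-1) ^ k * ((?C - ?C') * (central (p * k) ^ 2 * g (p * k))
      + ?C' * (central (p * k) ^ 2 - central k ^ 2) * g (p * k)
      + ?C' * central k ^ 2 * (g (p * k) - g' k)) \<in> padic_ball p (Suc s)"
      by (intro padic_ball_sign padic_ball_add)
    also have "(-1) ^ k * ((?C - ?C') * (central (p * k) ^ 2 * g (p * k))
      + ?C' * (central (p * k) ^ 2 - central k ^ 2) * g (p * k)
      + ?C' * central k ^ 2 * (g (p * k) - g' k)) = ?f (p * k) - ?f' k"
      unfolding sign by (simp add: algebra_simps)
    finally show ?thesis .
  qed
  ultimately show ?thesis
    unfolding eq by (intro padic_ball_add padic_ball_sum) auto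
qed

end

section \<open>Central binomial coefficients at the half-integers divisible by the prime\<close>

text \<open>For \<open>M = 2 n + 1\<close> the products over \<open>odd_part M\<close> and
  \<open>even_part M\<close> are \<open>(2 n - 1)!!\<close> and \<open>(2 n)!!\<close>, whose
  quotient is \<open>central n\<close>. As sets they are exchanged by a reflection.\<close>

definition odd_part :: "nat \<Rightarrow> nat set" where
  "odd_part M = {x. x < M \<and> odd x}"

definition even_part :: "nat \<Rightarrow> nat set" where
  "even_part M = {x. 0 < x \<and> x < M \<and> even x}"

lemma odd_part_eq: "odd_part (2 * n + 1) = (\<lambda>i. 2 * i + 1) ` {..<n}"
  by (auto simp: odd_part_def elim!: oddE)

lemma even_part_eq: "even_part (2 * n + 1) = (\<lambda>i. 2 * i + 2) ` {..<n}"
proof -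
  have "x \<in> (\<lambda>i. 2 * i + 2) ` {..<n}" if "0 < x" "x < 2 * n + 1" "even x" for x :: nat
    using that by (intro image_eqI[of _ _ "x div 2 - 1"]) (auto elim!: evenE)
  then show ?thesis by (auto simp: even_part_def)
qed

lemma finite_parity_parts [simp]: "finite (odd_part M)" "finite (even_part M)"
  by (simp_all add: odd_part_def even_part_def)

lemma card_parity_parts: "card (odd_part (2 * n + 1)) = n" "card (even_part (2 * n + 1)) = n"
  unfolding odd_part_eq even_part_eq by (simp_all add: card_image inj_on_def)

lemma central_parity_parts:
  "central n * of_nat (\<Prod>(even_part (2 * n + 1))) = of_nat (\<Prod>(odd_part (2 * n + 1)))"
proof -
  have "central n * (\<Prod>i<n. of_nat (2 * i + 2)) = (\<Prod>i<n. of_nat (2 * i + 1))"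
  proof (induction n)
    case (Suc n)
    have "central (Suc n) * (\<Prod>i<Suc n. of_nat (2 * i + 2))
        = (2 * of_nat (Suc n) * central (Suc n)) * (\<Prod>i<n. of_nat (2 * i + 2))"
      by (simp add: algebra_simps)
    also have "\<dots> = of_nat (2 * n + 1) * (central n * (\<Prod>i<n. of_nat (2 * i + 2)))"
      unfolding central_Suc by (simp only: mult.assoc)
    finally show ?case unfolding Suc by (simp add: mult.commute)
  qed simp
  then show ?thesis
    unfolding odd_part_eq even_part_eq by (subst (1 2) prod.reindex) (simp_all add: inj_on_def)
qed

lemma prod_cong_int:
  fixes f g :: "'a \<Rightarrow> int"
  assumes "\<And>x. x \<in> A \<Longrightarrow> n dvd f x - g x"
  shows "n dvd prod f A - prod g A"
proof -
  have "(\<Prod>x\<in>A. f x mod n) = (\<Prod>x\<in>A. g x mod n)"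
    using assms by (intro prod.cong) (auto simp: mod_eq_dvd_iff)
  then have "prod f A mod n = prod g A mod n"
    using mod_prod_eq[of f n A] mod_prod_eq[of g n A] by simp
  then show ?thesis by (simp add: mod_eq_dvd_iff)
qed

context odd_prime
begin

text \<open>Reduces a parity product below \<open>p M\<close> to the one below \<open>M\<close>, a
  power of \<open>p\<close> and a product of units.\<close>

lemma prod_split_multiples:
  assumes "finite A" "{x \<in> A. p dvd x} = (*) p ` B" "card B = n"
  shows "\<Prod>A = p ^ n * \<Prod>B * \<Prod>{x \<in> A. \<not> p dvd x}"
proof -
  have "\<Prod>A = \<Prod>{x \<in> A. p dvd x} * \<Prod>{x \<in> A. \<not> p dvd x}"
    using assms(1) by (subst prod.union_disjoint[symmetric]) (auto intro!: prod.cong)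
  also have "\<Prod>{x \<in> A. p dvd x} = (\<Prod>x\<in>B. p * x)"
    unfolding assms(2) using pos by (subst prod.reindex) (auto simp: inj_on_def)
  finally show ?thesis
    by (simp add: prod.distrib assms(3))
qed

text \<open>The reflection \<open>x \<mapsto> p (2 j + 1) - x\<close> exchanges the odd and the even units below
  \<open>p (2 j + 1)\<close>, so that up to sign their products agree modulo \<open>p (2 j + 1)\<close>.\<close>

lemma central_sq_half_integer:
  obtains U V :: nat where
    "central (p * j + (p - 1) div 2) * of_nat V = central j * of_nat U"
    "int (p * (2 * j + 1)) dvd int V ^ 2 - int U ^ 2"
    "\<not> p dvd U" "\<not> p dvd V"
proof -
  \<comment> \<open>\<open>J\<close> is the index with \<open>2 J + 1 = p (2 j + 1)\<close>.\<close>
  define J where "J = p * j + (p - 1) div 2"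
  define N where "N = p * (2 * j + 1)"
  have N: "2 * J + 1 = N" "odd N"
    using odd by (auto simp: J_def N_def elim!: oddE)
  define A B where "A = {x \<in> odd_part N. \<not> p dvd x}" and "B = {x \<in> even_part N. \<not> p dvd x}"
  have fin: "finite A" "finite B" by (simp_all add: A_def B_def)
  have "{x \<in> odd_part (p * M). p dvd x} = (*) p ` odd_part M" for M
    using pos odd by (auto simp: odd_part_def elim!: dvdE[where b = p])
  then have "{x \<in> odd_part N. p dvd x} = (*) p ` odd_part (2 * j + 1)"
    unfolding N_def .
  then have O: "\<Prod>(odd_part N) = p ^ j * \<Prod>(odd_part (2 * j + 1)) * \<Prod>A"
    unfolding A_def by (intro prod_split_multiples card_parity_parts) simp
  have "{x \<in> even_part (p * M). p dvd x} = (*) p ` even_part M" for M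
    using pos odd by (auto simp: even_part_def elim!: dvdE[where b = p])
  then have "{x \<in> even_part N. p dvd x} = (*) p ` even_part (2 * j + 1)"
    unfolding N_def .
  then have E: "\<Prod>(even_part N) = p ^ j * \<Prod>(even_part (2 * j + 1)) * \<Prod>B"
    unfolding B_def by (intro prod_split_multiples card_parity_parts) simp
  have "\<Prod>(even_part (2 * j + 1)) > 0"
    by (intro prod_pos) (auto simp: even_part_def)
  \<comment> \<open>The multiples of \<open>p\<close> contribute the same power \<open>p ^ j\<close>
    to both products and otherwise reproduce \<open>central j\<close>. Only the units remain:
    \<open>U\<close> is \<open>\<Prod>A\<close> and \<open>V\<close> is
    \<open>\<Prod>B\<close>.\<close>
  moreover have "central J * of_nat (p ^ j * \<Prod>(even_part (2 * j + 1)) * \<Prod>B)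
      = of_nat (p ^ j) * (central j * of_nat (\<Prod>(even_part (2 * j + 1)))) * of_nat (\<Prod>A)"
    using central_parity_parts[of J] unfolding N O E central_parity_parts[of j] by simp
  then have "of_nat (p ^ j * \<Prod>(even_part (2 * j + 1))) * (central J * of_nat (\<Prod>B))
      = of_nat (p ^ j * \<Prod>(even_part (2 * j + 1))) * (central j * of_nat (\<Prod>A))"
    by (simp only: of_nat_mult mult_ac)
  ultimately have 1: "central J * of_nat (\<Prod>B) = central j * of_nat (\<Prod>A)"
    using pos by (subst (asm) mult_cancel_left) (auto simp del: of_nat_prod of_nat_mult)
  have "p dvd N" by (simp add: N_def)
  then have reflect_p: "p dvd N - x \<longleftrightarrow> p dvd x" if "x \<le> N" for x
    using that by (blast intro: dvd_diff_nat dvd_diffD1)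
  have reflect_2: "odd (N - x) \<longleftrightarrow> even x" if "x \<le> N" for x
    using that N(2) by simp
  have "\<Prod>B = (\<Prod>x\<in>A. N - x)"
  proof (rule prod.reindex_bij_witness[of _ "\<lambda>x. N - x" "\<lambda>x. N - x"])
    fix x assume "x \<in> B"
    then show "N - (N - x) = x" "N - x \<in> A" "N - (N - x) = x"
      using reflect_p[of x] reflect_2[of x] by (auto simp: A_def B_def odd_part_def even_part_def)
  next
    fix x assume "x \<in> A"
    then show "N - (N - x) = x" "N - x \<in> B"
      using odd_pos[of x] reflect_p[of x] reflect_2[of x] by (auto simp: A_def B_def odd_part_def even_part_def)
  qed
  then have "int (\<Prod>B) = (\<Prod>x\<in>A. int N - int x)"
    by (simp add: A_def odd_part_def of_nat_diff)
  moreover have "int N dvd (\<Prod>x\<in>A. int N - int x) - (\<Prod>x\<in>A. - int x)"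
    by (rule prod_cong_int) simp
  moreover have "(\<Prod>x\<in>A. - int x) = (-1) ^ card A * int (\<Prod>A)"
    by (simp add: prod_uminus)
  ultimately have "int N dvd int (\<Prod>B) - (-1) ^ card A * int (\<Prod>A)"
    by simp
  \<comment> \<open>Squaring removes the sign \<open>(-1) ^ card A\<close>.\<close>
  then have "int N dvd (int (\<Prod>B)) ^ 2 - ((-1) ^ card A * int (\<Prod>A)) ^ 2"
    using diff_dvd_power_diff dvd_trans by blast
  then have 2: "int N dvd (int (\<Prod>B)) ^ 2 - (int (\<Prod>A)) ^ 2"
    by (simp add: power_mult_distrib power_mult[symmetric] mult.commute[of _ 2])
  have "\<not> p dvd \<Prod>A" "\<not> p dvd \<Prod>B"
    using prime fin by (auto simp: prime_dvd_prod_iff A_def B_def)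
  from that[OF 1[unfolded J_def] 2[unfolded N_def] this] show thesis .
qed

text \<open>This is the fact that \<open>(2 j + 1) binom(2 j, j)\<close> divides the least common multiple of
  \<open>1, \<dots>, 2 j + 1\<close>, read off from a partial fraction decomposition.\<close>

lemma prime_power_over_central_integral:
  assumes "j < p ^ r"
  shows "of_nat p ^ r / (of_nat (2 * j + 1) * central j) \<in> padic_ball p 0"
proof -
  \<comment> \<open>With \<open>x = j + 1\<close> the denominators run from \<open>j + 1\<close> to
    \<open>2 j + 1\<close>, and the sum is \<open>(j!)^2 / (2 j + 1)!\<close>.\<close>
  have "altbinom_sum (\<lambda>k. 1 / (of_nat (j + 1) + of_nat k)) j
      = fact j / pochhammer (of_nat (j + 1)) (Suc j)"
    by (rule altbinom_sum_inverse_shift) simp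
  also have "pochhammer (of_nat (j + 1)) (Suc j) = (fact (2 * j + 1) / fact j :: rat)"
  proof -
    have "j \<le> 2 * j + 1" "2 * j + 1 - j = Suc j" by simp_all
    then have "(fact (2 * j + 1) :: rat) = fact j * pochhammer (1 + of_nat j) (Suc j)"
      using pochhammer_product[of j "2 * j + 1" "1 :: rat"] by (simp only: pochhammer_fact)
    then show ?thesis by (simp only: of_nat_add of_nat_1 add.commute[of 1]) simp
  qed
  also have "fact j / (fact (2 * j + 1) / fact j) = (1 / (of_nat (2 * j + 1) * (central j * 4 ^ j)) :: rat)"
    by (simp add: central_def binomial_fact field_simps)
  finally have "of_nat p ^ r / (of_nat (2 * j + 1) * central j)
      = of_nat (4 ^ j) * (of_nat p ^ r * altbinom_sum (\<lambda>k. 1 / (of_nat (j + 1) + of_nat k)) j)"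
    by simp
  also have "of_nat p ^ r * altbinom_sum (\<lambda>k. 1 / (of_nat (j + 1) + of_nat k)) j
      = (\<Sum>k\<le>j. (-1) ^ k * (of_nat (j choose k) * (of_nat p ^ r / of_nat (j + 1 + k))))"
    unfolding altbinom_sum_def sum_distrib_left by (intro sum.cong refl) (simp add: mult_ac add_ac)
  also have "of_nat (4 ^ j) * \<dots> \<in> padic_ball p 0"
  proof (rule padic_ball_mult_integral(1)[OF padic_ball_of_nat padic_ball_sum],
      rule padic_ball_sign, rule padic_ball_mult_integral(1)[OF padic_ball_of_nat])
    fix k assume "k \<in> {..j}"
    then have "j + 1 + k < 2 * p ^ r" using assms by simp
    also have "\<dots> \<le> p ^ Suc r" using gt_2 by simp
    finally show "of_nat p ^ r / of_nat (j + 1 + k) \<in> padic_ball p 0"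
      by (intro padic_ball_prime_power_divide_small prime) simp_all
  qed
  finally show ?thesis .
qed

section \<open>Summands of \<open>inv_central_sum\<close> scaled by \<open>p ^ (3 r)\<close>\<close>

definition scaled_term :: "nat \<Rightarrow> nat \<Rightarrow> rat" where
  "scaled_term r j = of_nat p ^ (3 * r) * (1 / (of_nat (2 * j + 1) ^ 3 * central j ^ 2))"

text \<open>Distributes the \<open>3 r\<close> factors \<open>p\<close> so that for
  \<open>j < p ^ r\<close> each quotient is integral at \<open>p\<close>.\<close>

lemma scaled_term_eq:
  "scaled_term r j = of_nat p ^ r / of_nat (2 * j + 1)
    * (of_nat p ^ r / (of_nat (2 * j + 1) * central j)) ^ 2"
  by (simp add: scaled_term_def power2_eq_square power3_eq_cube power_mult mult.commute[of 3] mult_ac)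

lemma odd_lt_prime_power:
  assumes "j < p ^ r" shows "2 * j + 1 < p ^ Suc r"
proof -
  have "2 * j + 1 < 2 * p ^ r" using assms by simp
  also have "\<dots> \<le> p ^ Suc r" using gt_2 by simp
  finally show ?thesis .
qed

lemma scaled_term_integral:
  assumes "j < p ^ r" shows "scaled_term r j \<in> padic_ball p 0"
  unfolding scaled_term_eq using odd_lt_prime_power[OF assms]
  by (intro padic_ball_mult_integral padic_ball_power padic_ball_prime_power_divide_small prime
      prime_power_over_central_integral assms) simp_all

text \<open>With \<open>2 j + 1\<close> a unit, the first quotient in \<open>scaled_term_eq\<close>
  keeps its full factor \<open>p ^ r\<close>.\<close>

lemma scaled_term_vanishes:
  assumes "j < p ^ r" "\<not> p dvd 2 * j + 1" shows "scaled_term r j \<in> padic_ball p r"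
proof -
  have "of_nat p ^ r / of_nat (2 * j + 1) \<in> padic_ball p r"
    using padic_ball_prime_power_divide[OF prime assms(2), of 0 r] by simp
  then show ?thesis
    unfolding scaled_term_eq
    by (rule padic_ball_mult_integral(2)[rotated])
      (intro padic_ball_power prime_power_over_central_integral assms)
qed

text \<open>The ratio of the two terms is \<open>V ^ 2 / U ^ 2\<close> from
  \<open>central_sq_half_integer\<close>, which is 1 modulo \<open>p ^ (t + 1)\<close> when
  \<open>p ^ t\<close> exactly divides \<open>2 j + 1\<close>. The missing \<open>s - t\<close>
  factors come from \<open>Q\<close>, while \<open>E\<close> is integral.\<close>

lemma scaled_term_lift:
  assumes "j < p ^ s"
  shows "scaled_term (Suc s) (p * j + (p - 1) div 2) - scaled_term s j \<in> padic_ball p (Suc s)"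
proof -
  define J where "J = p * j + (p - 1) div 2"
  obtain U V :: nat where
    UV: "central J * of_nat V = central j * of_nat U"
      "int (p * (2 * j + 1)) dvd int V ^ 2 - int U ^ 2" "\<not> p dvd U" "\<not> p dvd V"
    using central_sq_half_integer[of j] unfolding J_def by blast
  have nz: "U > 0" "V > 0" using UV(3,4) by (auto intro: Nat.gr0I)
  have J: "of_nat (2 * J + 1) = of_nat p * (of_nat (2 * j + 1) :: rat)"
  proof -
    have "2 * J + 1 = p * (2 * j + 1)"
      using odd by (auto simp: J_def elim!: oddE)
    then show ?thesis by (simp only: of_nat_mult)
  qed
  have "2 * j + 1 > 0" by simp
  then obtain t u where tu: "2 * j + 1 = p ^ t * u" "\<not> p dvd u"
    by (rule prime_decompose[OF prime])
  have ts: "t \<le> s"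
    using prime_power_le_exponent[OF prime, of t u s] odd_lt_prime_power[OF assms] tu by simp
  define Q where "Q = of_nat p ^ s / (of_nat (2 * j + 1) :: rat)"
  define E where "E = of_nat p ^ s / (of_nat (2 * j + 1) * central j)"
  have Q: "Q \<in> padic_ball p (s - t)"
    unfolding Q_def tu(1) by (rule padic_ball_prime_power_divide[OF prime tu(2) ts])
  have E: "E \<in> padic_ball p 0"
    unfolding E_def by (rule prime_power_over_central_integral[OF assms])
  have "int p ^ Suc t dvd int (p * (2 * j + 1))"
    unfolding tu(1) by simp
  then have "int p ^ Suc t dvd int V ^ 2 - int U ^ 2"
    using UV(2) dvd_trans by blast
  then have D: "of_int (int V ^ 2 - int U ^ 2) / of_int (int U ^ 2) \<in> padic_ball p (Suc t)"
    using nz UV(3) prime by (intro padic_ball_divide padic_ball_of_int)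
      (auto simp: coprime_commute[of _ p] prime_imp_coprime)
  have cJ: "central J = central j * of_nat U / of_nat V"
    using UV(1) nz by (simp add: field_simps)
  have "of_nat p ^ Suc s / (of_nat (2 * J + 1) * central J) = E * (of_nat V / of_nat U)"
    unfolding J E_def cJ using pos nz central_pos[of j]
    by (simp add: field_simps del: of_nat_add of_nat_mult of_nat_Suc)
  moreover have "of_nat p ^ Suc s / of_nat (2 * J + 1) = Q"
    unfolding J Q_def using pos by simp
  ultimately have "scaled_term (Suc s) J = Q * E ^ 2 * (of_nat V ^ 2 / of_nat U ^ 2)"
    unfolding scaled_term_eq by (simp add: power_mult_distrib power_divide)
  moreover have "scaled_term s j = Q * E ^ 2"
    by (simp add: scaled_term_eq Q_def E_def)
  ultimately have "scaled_term (Suc s) J - scaled_term s j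
      = E ^ 2 * (Q * (of_int (int V ^ 2 - int U ^ 2) / of_int (int U ^ 2)))"
    using nz by (simp add: field_simps)
  moreover have "E ^ 2 * (Q * (of_int (int V ^ 2 - int U ^ 2) / of_int (int U ^ 2)))
      \<in> padic_ball p ((s - t) + Suc t)"
    by (intro padic_ball_mult_integral padic_ball_power padic_ball_mult Q E D)
  ultimately show ?thesis
    using ts by (simp add: J_def)
qed

text \<open>If \<open>p\<close> divides \<open>2 x + 1\<close>, the cofactor is odd, so
  \<open>2 x + 1 = p (2 j + 1)\<close> and \<open>x = p j + (p - 1) / 2\<close>; the bound
  \<open>x < p k\<close> corresponds to \<open>j < k\<close>. These terms are lifts of the terms of
  the shorter sum, and all others vanish.\<close>

lemma sum_scaled_term_lift:
  assumes "k \<le> p ^ s"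
  shows "(\<Sum>j<p * k. scaled_term (Suc s) j) - (\<Sum>j<k. scaled_term s j) \<in> padic_ball p (Suc s)"
proof -
  define h where "h = (p - 1) div 2"
  have h: "p = 2 * h + 1" using odd by (auto simp: h_def elim!: oddE)
  let ?A = "{j. j < p * k \<and> p dvd 2 * j + 1}" and ?B = "{j. j < p * k \<and> \<not> p dvd 2 * j + 1}"
  have "?A = (\<lambda>j. p * j + h) ` {..<k}"
  proof (intro equalityI subsetI)
    fix x assume x: "x \<in> ?A"
    then obtain M where M: "2 * x + 1 = p * M" by (auto elim: dvdE)
    then have "odd (p * M)" by presburger
    then obtain j where "M = 2 * j + 1" by (auto elim: oddE)
    with M have xj: "x = p * j + h" by (simp add: h algebra_simps)
    have "p * j + h < p * k" using x unfolding xj by blast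
    then have "p * j < p * k" by (rule le_less_trans[OF le_add1])
    then have "j < k" by simp
    then show "x \<in> (\<lambda>j. p * j + h) ` {..<k}" unfolding xj by (intro imageI) simp
  next
    fix x assume "x \<in> (\<lambda>j. p * j + h) ` {..<k}"
    then obtain j where j: "j < k" "x = p * j + h" by auto
    then have "p * (j + 1) \<le> p * k" by (intro mult_le_mono2) simp
    moreover have "p * (j + 1) = p * j + p" "h < p" using h by simp_all
    ultimately have "x < p * k" using j(2) by linarith
    moreover have "2 * x + 1 = p * (2 * j + 1)" by (simp add: j(2) h algebra_simps)
    then have "p dvd 2 * x + 1" by (simp only: dvd_triv_left)
    ultimately show "x \<in> ?A" by blast
  qed
  then have "sum (scaled_term (Suc s)) ?A = (\<Sum>j<k. scaled_term (Suc s) (p * j + h))"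
    using pos by (simp add: sum.reindex inj_on_def)
  moreover have "(\<Sum>j<p * k. scaled_term (Suc s) j) = sum (scaled_term (Suc s)) ?A + sum (scaled_term (Suc s)) ?B"
    by (subst sum.union_disjoint[symmetric]) (auto intro!: sum.cong)
  ultimately have "(\<Sum>j<p * k. scaled_term (Suc s) j) - (\<Sum>j<k. scaled_term s j)
      = (\<Sum>j<k. scaled_term (Suc s) (p * j + h) - scaled_term s j) + sum (scaled_term (Suc s)) ?B"
    by (simp add: sum_subtractf)
  moreover have "scaled_term (Suc s) j \<in> padic_ball p (Suc s)" if "j \<in> ?B" for j
  proof -
    have "j < p * k" using that by simp
    also have "\<dots> \<le> p ^ Suc s" using assms by simp
    finally show ?thesis using that by (intro scaled_term_vanishes) auto
  qed
  moreover have "scaled_term (Suc s) (p * j + h) - scaled_term s j \<in> padic_ball p (Suc s)"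
    if "j < k" for j
    unfolding h_def using that assms by (intro scaled_term_lift) simp
  ultimately show ?thesis
    by (simp only:) (intro padic_ball_add padic_ball_sum; simp)
qed

section \<open>The two congruences\<close>

text \<open>Brings \<open>Jt3\<close> into the shape \<open>central k ^ 2\<close> times a weight
  that \<open>altbinom_sum_central_congruence\<close> handles.\<close>

lemma Jt3_scaled:
  "Jt3 n * of_nat p ^ (3 * r)
    = altbinom_sum (\<lambda>k. central k ^ 2 * (- 2 * (\<Sum>j<k. scaled_term r j))) n"
  unfolding Jt3_closed altbinom_sum_def sum_distrib_right
  by (intro sum.cong refl)
    (simp add: inv_central_sum_def scaled_term_def sum_distrib_left[symmetric]
      del: times_divide_eq_right mult_1_right)

lemma Jt2_congruence:
  "Jt2 (p * (p ^ s * m)) - Jt2 (p ^ s * m) \<in> padic_ball p (Suc s)"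
  using altbinom_sum_central_congruence[OF refl, of s m "\<lambda>_. 1" "\<lambda>_. 1"]
    padic_ball_of_nat[of 1 p] padic_ball_zero
  by (simp add: Jt2_closed)

text \<open>The index is a pure power of \<open>p\<close> because integrality of the weights comes
  from \<open>scaled_term_integral\<close>, which covers \<open>j < p ^ r\<close> and hence
  \<open>k \<le> p ^ r\<close>.\<close>

lemma Jt3_congruence:
  "Jt3 (p ^ Suc s) * of_nat p ^ (3 * Suc s) - Jt3 (p ^ s) * of_nat p ^ (3 * s) \<in> padic_ball p (Suc s)"
proof -
  have m2: "- 2 \<in> padic_ball p 0"
    using padic_ball_of_int[of p 0 "- 2"] by simp
  have int: "- 2 * (\<Sum>j<k. scaled_term r j) \<in> padic_ball p 0" if "k \<le> p ^ r" for k r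
    using that by (intro padic_ball_mult_integral m2 padic_ball_sum scaled_term_integral) simp
  have "- 2 * (\<Sum>j<p * k. scaled_term (Suc s) j) - (- 2 * (\<Sum>j<k. scaled_term s j)) \<in> padic_ball p (Suc s)"
    if "k \<le> p ^ s" for k
    unfolding right_diff_distrib[symmetric]
    by (rule padic_ball_mult_integral(1)[OF m2 sum_scaled_term_lift[OF that]])
  then show ?thesis
    unfolding Jt3_scaled power_Suc
    by (intro altbinom_sum_central_congruence[where m = 1] int) simp_all
qed

end

theorem theorem6p3:
  fixes p m r :: nat
  assumes "prime p" and "odd p" and "m > 0" and "r > 0"
  shows "[Jt2 (m * p ^ r) \<equiv> Jt2 (m * p ^ (r - 1))] (rmod p ^ r) \<and>
         [Jt3 (p ^ r) * of_nat p ^ (3 * r) \<equiv> Jt3 (p ^ (r - 1)) * of_nat p ^ (3 * (r - 1))] (rmod p ^ r)"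
proof -
  interpret odd_prime p by standard (fact assms(1,2))+
  obtain s where r: "r = Suc s" using assms(4) by (cases r) auto
  have "Jt2 (m * p ^ r) - Jt2 (m * p ^ (r - 1)) \<in> padic_ball p r"
    using Jt2_congruence[of s m] by (simp add: r mult_ac)
  moreover have "Jt3 (p ^ r) * of_nat p ^ (3 * r) - Jt3 (p ^ (r - 1)) * of_nat p ^ (3 * (r - 1)) \<in> padic_ball p r"
    using Jt3_congruence[of s] by (simp only: r diff_Suc_1)
  ultimately show ?thesis by (intro conjI rat_cong_padic_ball)
qed

end
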